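(* Let $k\ge 1$ be an integer, let $r=2k+2\ge 4$, and let $\mathcal{M}$ be a rank $r$ Lawrence oriented matroid on $n\ge 6k+2=3r-4$ elements. Then $$f_{\mathcal{M}}(r,n,k)\le c_r(n,k).$$
   Context: An oriented matroid $\mathcal{M}=(E,\mathcal{C})$ is given by its finite ground set $E$ and its set $\mathcal{C}\subseteq\{+,-,0\}^E$ of signed circuits; for a sign vector $X$, $X^+$ and $X^-$ are the sets of positive and negative elements and $\underline{X}=X^+\cup X^-$ is the support. All oriented matroids are simple (all circuits have size at least $3$). For $R\subseteq E$, the reorientation ${}_{-R}\mathcal{M}$ is obtained from $\mathcal{M}$ by reversing the sign of $X_e$ for every $e\in R$ and every circuit $X$. For an integer $k\ge 0$, $\mathcal{M}$ is $k$-neighborly if $|X^+|>k$ and $|X^-|>k$ for every circuit $X$. For an oriented matroid $\mathcal{M}$ of rank $r$ on $n$ elements, $f_{\mathcal{M}}(r,n,k)$ denotes the number of subsets $R\subseteq E$ such that ${}_{-R}\mathcal{M}$ is $k$-neighborly. The alternating oriented matroid $C_r(n)$ is the uniform oriented matroid of rank $r$ on $[n]=\{1,\dots,n\}$ in which every circuit $X$ with support $i_1<\dots<i_{r+1}$ satisfies $X_{i_j}=-X_{i_{j+1}}$ for $1\le j\le r$. Put $c_r(n,k)=f_{C_r(n)}(r,n,k)$. Lawrence oriented matroid (LOM): for an $r\times n$ matrix $A=(a_{i,j})$ with entries in $\{+1,-1\}$, $r\le n$, $\mathcal{M}_A$ is the uniform oriented matroid of rank $r$ on $[n]$ with chirotope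 $\chi(j_1,\dots,j_r)=\prod_{i=1}^r a_{i,j_i}$ for $j_1<\dots<j_r$. Equivalently, its circuits are the sign vectors $X$ with support $j_1<\dots<j_{r+1}$ such that $X_{j_{i+1}}=-X_{j_i}a_{i,j_i}a_{i,j_{i+1}}$ for $1\le i\le r$. A rank $r$ LOM on $n$ elements is an oriented matroid of the form $\mathcal{M}_A$ for such a matrix $A$. *)

theory Defs
  imports Main
begin

text \<open>Sign vectors are functions with values in \<open>{-1, 0, 1}\<close> that vanish outside the ground set.\<close>

record 'a om =
  ground :: "'a set"
  circuits :: "('a \<Rightarrow> int) set"

definition pos :: "('a \<Rightarrow> int) \<Rightarrow> 'a set" where
  "pos X = {e. X e = 1}"

definition neg :: "('a \<Rightarrow> int) \<Rightarrow> 'a set" where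
  "neg X = {e. X e = -1}"

definition supp :: "('a \<Rightarrow> int) \<Rightarrow> 'a set" where
  "supp X = pos X \<union> neg X"

definition sign_vectors :: "'a set \<Rightarrow> ('a \<Rightarrow> int) set" where
  "sign_vectors E = {X. (\<forall>e. X e \<in> {-1, 0, 1}) \<and> (\<forall>e. e \<notin> E \<longrightarrow> X e = 0)}"

text \<open>The signed circuit axioms, with weak elimination.  Simplicity (all circuits have at least 3
  elements) is not an axiom here: by \<open>uniform_circuit_card\<close> below it is automatic for uniform
  oriented matroids of rank at least 2.\<close>

definition oriented_matroid :: "'a om \<Rightarrow> bool" where
  "oriented_matroid M \<longleftrightarrow>
     finite (ground M) \<and>
     circuits M \<subseteq> sign_vectors (ground M) \<and>
     (\<lambda>e. 0) \<notin> circuits M \<and>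
     (\<forall>X \<in> circuits M. (\<lambda>e. - X e) \<in> circuits M) \<and>
     (\<forall>X \<in> circuits M. \<forall>Y \<in> circuits M. supp X \<subseteq> supp Y \<longrightarrow> X = Y \<or> X = (\<lambda>e. - Y e)) \<and>
     (\<forall>X \<in> circuits M. \<forall>Y \<in> circuits M. \<forall>e. X \<noteq> (\<lambda>e. - Y e) \<and> e \<in> pos X \<inter> neg Y \<longrightarrow>
        (\<exists>Z \<in> circuits M. pos Z \<subseteq> (pos X \<union> pos Y) - {e} \<and> neg Z \<subseteq> (neg X \<union> neg Y) - {e}))"

definition indep_om :: "'a om \<Rightarrow> 'a set \<Rightarrow> bool" where
  "indep_om M I \<longleftrightarrow> I \<subseteq> ground M \<and> \<not> (\<exists>X \<in> circuits M. supp X \<subseteq> I)"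

definition basis_om :: "'a om \<Rightarrow> 'a set \<Rightarrow> bool" where
  "basis_om M B \<longleftrightarrow> indep_om M B \<and> (\<forall>I. indep_om M I \<and> B \<subseteq> I \<longrightarrow> I = B)"

definition rank_om :: "'a om \<Rightarrow> nat" where
  "rank_om M = Max (card ` {I. indep_om M I})"

definition uniform_om :: "'a om \<Rightarrow> bool" where
  "uniform_om M \<longleftrightarrow> (\<forall>B. B \<subseteq> ground M \<and> card B = rank_om M \<longrightarrow> basis_om M B)"

text \<open>A chirotope is an alternating map on the \<open>r\<close>-tuples of elements, \<open>r\<close> the rank, which is
  nonzero exactly on the ordered bases.  The last clause ties it to the circuits: if two ordered
  bases differ only in their first entries \<open>e\<close> and \<open>f\<close>, then the quotient of their signs is
  \<open>- X e * X f\<close>, where \<open>X\<close> is either of the two opposite circuits contained in their union.\<close>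

definition chirotope :: "'a om \<Rightarrow> ('a list \<Rightarrow> int) \<Rightarrow> bool" where
  "chirotope M \<chi> \<longleftrightarrow>
     (\<forall>xs. set xs \<subseteq> ground M \<and> length xs = rank_om M \<longrightarrow>
        \<chi> xs \<in> {-1, 0, 1} \<and>
        (\<chi> xs \<noteq> 0 \<longleftrightarrow> distinct xs \<and> basis_om M (set xs)) \<and>
        (\<forall>i j. i < j \<and> j < rank_om M \<longrightarrow> \<chi> (xs[i := xs ! j, j := xs ! i]) = - \<chi> xs)) \<and>
     (\<forall>e f xs X. e \<noteq> f \<and> Suc (length xs) = rank_om M \<and>
        distinct (e # xs) \<and> basis_om M (set (e # xs)) \<and>
        distinct (f # xs) \<and> basis_om M (set (f # xs)) \<and>
        X \<in> circuits M \<and> supp X \<subseteq> set (e # f # xs) \<longrightarrow>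
        \<chi> (f # xs) = - X e * X f * \<chi> (e # xs))"

definition reorient :: "'a set \<Rightarrow> 'a om \<Rightarrow> 'a om" where
  "reorient R M =
     \<lparr>ground = ground M, circuits = (\<lambda>X e. if e \<in> R then - X e else X e) ` circuits M\<rparr>"

definition neighborly :: "nat \<Rightarrow> 'a om \<Rightarrow> bool" where
  "neighborly k M \<longleftrightarrow> (\<forall>X \<in> circuits M. card (pos X) > k \<and> card (neg X) > k)"

text \<open>\<open>f_om M k\<close> is $f_M(r,n,k)$; the rank \<open>r\<close> and the number \<open>n\<close> of elements are determined
  by \<open>M\<close>.\<close>

definition f_om :: "'a om \<Rightarrow> nat \<Rightarrow> nat" where
  "f_om M k = card {R. R \<subseteq> ground M \<and> neighborly k (reorient R M)}"

text \<open>The alternating oriented matroid, given by its full set of circuits; \<open>alternating_om_unique\<close>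
  below shows that no other uniform oriented matroid of rank \<open>r\<close> on \<open>{1..n}\<close> has only alternating
  circuits.  Positions in lists count from 0.\<close>

definition alternating_vector :: "nat \<Rightarrow> (nat \<Rightarrow> int) \<Rightarrow> bool" where
  "alternating_vector r X \<longleftrightarrow>
     (let js = sorted_list_of_set (supp X) in \<forall>i < r. X (js ! i) = - X (js ! Suc i))"

definition alternating_om :: "nat \<Rightarrow> nat \<Rightarrow> nat om" where
  "alternating_om r n =
     \<lparr>ground = {1..n},
      circuits = {X \<in> sign_vectors {1..n}. card (supp X) = Suc r \<and> alternating_vector r X}\<rparr>"

definition c_alt :: "nat \<Rightarrow> nat \<Rightarrow> nat \<Rightarrow> nat" where
  "c_alt r n k = f_om (alternating_om r n) k"

text \<open>\<open>is_LOM_of r n A M\<close> says that \<open>M\<close> is $M_A$ for the \<open>r \<times> n\<close> matrix \<open>A\<close>, with rows and columns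
  indexed from 1.  The product formula prescribes the chirotope on increasing tuples, hence, as it
  is alternating, on all tuples.\<close>

definition is_LOM_of :: "nat \<Rightarrow> nat \<Rightarrow> (nat \<Rightarrow> nat \<Rightarrow> int) \<Rightarrow> nat om \<Rightarrow> bool" where
  "is_LOM_of r n A M \<longleftrightarrow>
     oriented_matroid M \<and> ground M = {1..n} \<and> rank_om M = r \<and> uniform_om M \<and>
     (\<exists>\<chi>. chirotope M \<chi> \<and>
        (\<forall>js. length js = r \<and> set js \<subseteq> {1..n} \<and> sorted_wrt (<) js \<longrightarrow>
           \<chi> js = (\<Prod>i<r. A (Suc i) (js ! i))))"

definition is_LOM :: "nat \<Rightarrow> nat \<Rightarrow> nat om \<Rightarrow> bool" where
  "is_LOM r n M \<longleftrightarrow> r \<le> n \<and>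
     (\<exists>A. (\<forall>i\<in>{1..r}. \<forall>j\<in>{1..n}. A i j \<in> {-1, 1}) \<and> is_LOM_of r n A M)"

lemma supp_iff:
  assumes "X \<in> sign_vectors E"
  shows "e \<in> supp X \<longleftrightarrow> X e \<noteq> 0"
proof -
  have "X e \<in> {-1, 0, 1}" using assms unfolding sign_vectors_def by blast
  then show ?thesis by (auto simp: supp_def pos_def neg_def)
qed

lemma supp_subset: "X \<in> sign_vectors E \<Longrightarrow> supp X \<subseteq> E"
  by (auto simp: supp_iff) (auto simp: sign_vectors_def)

lemma indep_card_le_rank:
  assumes "finite (ground M)" "indep_om M I"
  shows "card I \<le> rank_om M"
proof -
  have "{I. indep_om M I} \<subseteq> Pow (ground M)" by (auto simp: indep_om_def)
  then have "finite {I. indep_om M I}" using assms(1) by (meson finite_Pow_iff finite_subset)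
  then show ?thesis unfolding rank_om_def using assms(2) by (intro Max_ge) auto
qed

lemma rank_le_card_ground:
  assumes "oriented_matroid M"
  shows "rank_om M \<le> card (ground M)"
proof -
  have fin: "finite (ground M)" using assms by (simp add: oriented_matroid_def)
  have sub: "{I. indep_om M I} \<subseteq> Pow (ground M)" by (auto simp: indep_om_def)
  then have fin2: "finite {I. indep_om M I}" using fin by (meson finite_Pow_iff finite_subset)
  have "indep_om M {}"
  proof -
    have "X = (\<lambda>e. 0)" if "X \<in> circuits M" "supp X = {}" for X
    proof
      fix e
      have "X \<in> sign_vectors (ground M)" using assms that(1) by (auto simp: oriented_matroid_def)
      then show "X e = 0" using supp_iff[of X _ e] that(2) by auto
    qed
    then show ?thesis using assms unfolding indep_om_def oriented_matroid_def by auto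
  qed
  then have "rank_om M \<in> card ` {I. indep_om M I}"
    unfolding rank_om_def using fin2 by (intro Max_in) auto
  then show ?thesis using fin by (auto simp: indep_om_def card_mono)
qed

lemma uniform_circuit_card:
  assumes om: "oriented_matroid M" and un: "uniform_om M" and X: "X \<in> circuits M"
  shows "card (supp X) = Suc (rank_om M)"
proof -
  let ?r = "rank_om M"
  have fin: "finite (ground M)" using om by (simp add: oriented_matroid_def)
  have XE: "supp X \<subseteq> ground M"
    using om X supp_subset by (auto simp: oriented_matroid_def)
  have finX: "finite (supp X)" using XE fin finite_subset by blast
  have "\<not> card (supp X) \<le> ?r"
  proof
    assume "card (supp X) \<le> ?r"
    then obtain B where B: "supp X \<subseteq> B" "B \<subseteq> ground M" "card B = ?r"
      using exists_subset_between[OF _ rank_le_card_ground[OF om] XE fin] by blast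
    then have "indep_om M B" using un by (auto simp: uniform_om_def basis_om_def)
    then show False using X B(1) by (auto simp: indep_om_def)
  qed
  moreover have "\<not> Suc ?r < card (supp X)"
  proof
    assume less: "Suc ?r < card (supp X)"
    then obtain J where J: "J \<subseteq> supp X" "card J = Suc ?r"
      using obtain_subset_with_card_n[of "Suc ?r" "supp X"] by (metis less_imp_le)
    have "\<not> indep_om M J" using indep_card_le_rank[OF fin] J(2) by fastforce
    then obtain Y where Y: "Y \<in> circuits M" "supp Y \<subseteq> J"
      using J(1) XE by (auto simp: indep_om_def)
    then have "Y = X \<or> Y = (\<lambda>e. - X e)"
      using om X J(1) unfolding oriented_matroid_def by (meson order_trans)
    then have "supp Y = supp X" by (auto simp: supp_def pos_def neg_def)
    then show False using J Y less finX by (metis antisym less_irrefl)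
  qed
  ultimately show ?thesis by linarith
qed

lemma uniform_ex_circuit:
  assumes om: "oriented_matroid M" and un: "uniform_om M"
    and J: "J \<subseteq> ground M" "card J = Suc (rank_om M)"
  shows "\<exists>X \<in> circuits M. supp X = J"
proof -
  have fin: "finite (ground M)" using om by (simp add: oriented_matroid_def)
  have "\<not> indep_om M J" using indep_card_le_rank[OF fin] J(2) by fastforce
  then obtain Y where Y: "Y \<in> circuits M" "supp Y \<subseteq> J"
    using J(1) by (auto simp: indep_om_def)
  then have "supp Y = J"
    using uniform_circuit_card[OF om un Y(1)] J fin by (metis card_subset_eq finite_subset)
  then show ?thesis using Y(1) by blast
qed

lemma circuits_eqI:
  fixes M :: "nat om" and s :: "nat list \<Rightarrow> nat \<Rightarrow> int"
  assumes om: "oriented_matroid M" and un: "uniform_om M" and r: "rank_om M = r"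
    and rec: "\<And>X js. X \<in> circuits M \<Longrightarrow> js = sorted_list_of_set (supp X) \<Longrightarrow>
      \<forall>i<r. X (js ! Suc i) = s js i * X (js ! i)"
  shows "circuits M = {X \<in> sign_vectors (ground M). card (supp X) = Suc r \<and>
    (let js = sorted_list_of_set (supp X) in \<forall>i<r. X (js ! Suc i) = s js i * X (js ! i))}"
    (is "_ = ?R")
proof
  show "circuits M \<subseteq> ?R"
  proof
    fix X assume X: "X \<in> circuits M"
    then have "X \<in> sign_vectors (ground M)" using om by (auto simp: oriented_matroid_def)
    then show "X \<in> ?R"
      using uniform_circuit_card[OF om un X] rec[OF X refl] r unfolding Let_def by blast
  qed
  show "?R \<subseteq> circuits M"
  proof
    fix Z assume Z: "Z \<in> ?R"
    then have Zs: "Z \<in> sign_vectors (ground M)" by simp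
    define js where "js = sorted_list_of_set (supp Z)"
    have finZ: "finite (supp Z)" using Z card_ge_0_finite[of "supp Z"] by simp
    have len: "length js = Suc r" "set js = supp Z"
      using Z finZ by (auto simp: js_def)
    have Zrec: "\<forall>i<r. Z (js ! Suc i) = s js i * Z (js ! i)"
      using Z by (simp add: Let_def js_def)
    obtain X where X: "X \<in> circuits M" "supp X = supp Z"
      using uniform_ex_circuit[OF om un supp_subset[OF Zs]] Z r by auto
    have Xs: "X \<in> sign_vectors (ground M)" using om X(1) by (auto simp: oriented_matroid_def)
    have Xrec: "\<forall>i<r. X (js ! Suc i) = s js i * X (js ! i)"
      using rec[OF X(1)] X(2) by (simp add: js_def)
    have "js ! 0 \<in> supp Z" using len by (metis nth_mem zero_less_Suc)
    then have ne: "Z (js ! 0) \<noteq> 0" "X (js ! 0) \<noteq> 0"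
      using supp_iff[OF Zs] supp_iff[OF Xs] X(2) by auto
    have v: "Z (js ! 0) \<in> {-1,0,1}" "X (js ! 0) \<in> {-1,0,1}"
      using Zs Xs unfolding sign_vectors_def by blast+
    obtain c :: int where c: "c = 1 \<or> c = -1" "Z (js ! 0) = c * X (js ! 0)"
    proof (cases "Z (js ! 0) = X (js ! 0)")
      case True
      then show ?thesis using that[of 1] by simp
    next
      case False
      then have "Z (js ! 0) = - X (js ! 0)" using v ne by auto
      then show ?thesis using that[of "-1"] by simp
    qed
    have eq: "Z (js ! i) = c * X (js ! i)" if "i \<le> r" for i
      using that
    proof (induction i)
      case 0
      then show ?case using c(2) by simp
    next
      case (Suc i)
      then have "Z (js ! i) = c * X (js ! i)" "i < r" by auto
      then show ?case using Zrec Xrec by (metis mult.left_commute)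
    qed
    have "Z e = c * X e" for e
    proof (cases "e \<in> supp Z")
      case True
      then obtain i where "i < Suc r" "e = js ! i" using len by (metis in_set_conv_nth)
      then show ?thesis using eq by simp
    next
      case False
      then show ?thesis using supp_iff[OF Zs] supp_iff[OF Xs] X(2) by auto
    qed
    then have "Z = (\<lambda>e. c * X e)" by (rule ext)
    then have "Z = X \<or> Z = (\<lambda>e. - X e)" using c(1) by (elim disjE) simp_all
    then show "Z \<in> circuits M" using om X(1) by (auto simp: oriented_matroid_def)
  qed
qed

lemma alternating_om_unique:
  fixes M :: "nat om"
  assumes om: "oriented_matroid M" and un: "uniform_om M"
    and r: "rank_om M = r" and gr: "ground M = {1..n}"
    and alt: "\<forall>X \<in> circuits M. alternating_vector r X"
  shows "M = alternating_om r n"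
proof -
  have "circuits M = {X \<in> sign_vectors (ground M). card (supp X) = Suc r \<and>
    (let js = sorted_list_of_set (supp X) in \<forall>i<r. X (js ! Suc i) = (-1) * X (js ! i))}"
  proof (rule circuits_eqI[OF om un r])
    fix X js assume X: "X \<in> circuits M" and js: "js = sorted_list_of_set (supp X)"
    have "\<forall>i<r. X (js ! i) = - X (js ! Suc i)"
      using alt X js by (simp add: alternating_vector_def Let_def)
    then show "\<forall>i<r. X (js ! Suc i) = (-1) * X (js ! i)" by simp
  qed
  also have "\<dots> = circuits (alternating_om r n)"
  proof -
    have "(b = (-1) * a) = (a = - b)" for a b :: int by auto
    then show ?thesis unfolding alternating_om_def alternating_vector_def gr Let_def by simp
  qed
  finally show ?thesis using gr by (simp add: alternating_om_def)
qed

lemma chirotope_move: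
  assumes "chirotope M \<chi>" "set (e # us @ vs) \<subseteq> ground M" "Suc (length (us @ vs)) = rank_om M"
  shows "\<chi> (us @ e # vs) = (-1) ^ length us * \<chi> (e # us @ vs)"
  using assms(2,3)
proof (induction us arbitrary: vs rule: rev_induct)
  case Nil
  then show ?case by simp
next
  case (snoc u us)
  let ?ys = "us @ e # u # vs"
  have sw: "?ys[length us := ?ys ! Suc (length us), Suc (length us) := ?ys ! length us]
      = us @ u # e # vs"
    by (simp add: nth_append list_update_append)
  have alt: "\<forall>xs. set xs \<subseteq> ground M \<and> length xs = rank_om M \<longrightarrow>
      (\<forall>i j. i < j \<and> j < rank_om M \<longrightarrow> \<chi> (xs[i := xs ! j, j := xs ! i]) = - \<chi> xs)"
    using assms(1) unfolding chirotope_def by simp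
  have "set ?ys \<subseteq> ground M" "length ?ys = rank_om M" "Suc (length us) < rank_om M"
    using snoc.prems by auto
  then have "\<chi> (?ys[length us := ?ys ! Suc (length us), Suc (length us) := ?ys ! length us])
      = - \<chi> ?ys"
    using alt by (metis lessI)
  then have "\<chi> (us @ u # e # vs) = - \<chi> ?ys" unfolding sw .
  moreover have "\<chi> ?ys = (-1) ^ length us * \<chi> (e # us @ u # vs)"
    using snoc.IH[of "u # vs"] snoc.prems by simp
  ultimately show ?case by simp
qed

lemma solve_sign:
  fixes u v x y p :: int
  assumes "u \<in> {-1, 1}" "x \<in> {-1, 1}" "p \<noteq> 0" "v * p = - x * y * (u * p)"
  shows "y = - u * v * x"
proof -
  have "v * p = (- x * y * u) * p" using assms(4) by (simp only: mult.assoc)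
  then have "v = - x * y * u" using assms(3) mult_right_cancel[of p v "- x * y * u"] by blast
  then show ?thesis using assms(1,2) by auto
qed

text \<open>The description of the circuits of $M_A$ in terms of the entries of \<open>A\<close>.\<close>

lemma is_LOM_of_circuits:
  assumes LOM: "is_LOM_of r n A M"
    and A: "\<forall>i\<in>{1..r}. \<forall>j\<in>{1..n}. A i j \<in> {-1, 1}"
  shows "circuits M = {X \<in> sign_vectors {1..n}. card (supp X) = Suc r \<and>
    (let js = sorted_list_of_set (supp X) in
      \<forall>i<r. X (js ! Suc i) = - A (Suc i) (js ! i) * A (Suc i) (js ! Suc i) * X (js ! i))}"
proof -
  have om: "oriented_matroid M" and gr: "ground M = {1..n}" and r: "rank_om M = r"
    and un: "uniform_om M" using LOM by (auto simp: is_LOM_of_def)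
  obtain \<chi> where chi: "chirotope M \<chi>" and prd: "\<And>js. length js = r \<Longrightarrow> set js \<subseteq> {1..n} \<Longrightarrow>
      sorted_wrt (<) js \<Longrightarrow> \<chi> js = (\<Prod>i<r. A (Suc i) (js ! i))"
    using LOM by (auto simp: is_LOM_of_def)
  have step: "\<forall>i<r. X (js ! Suc i) = - A (Suc i) (js ! i) * A (Suc i) (js ! Suc i) * X (js ! i)"
    if X: "X \<in> circuits M" and js: "js = sorted_list_of_set (supp X)" for X js
  proof (intro allI impI)
    fix i assume i: "i < r"
    have Xs: "X \<in> sign_vectors {1..n}" using om X gr by (auto simp: oriented_matroid_def)
    have cX: "card (supp X) = Suc r" using uniform_circuit_card[OF om un X] r by simp
    have finX: "finite (supp X)" using cX card_ge_0_finite[of "supp X"] by simp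
    have len: "length js = Suc r" and st: "set js = supp X" and so: "sorted_wrt (<) js"
      using cX finX js by auto
    define us vs e f where "us = take i js" and "vs = drop (Suc (Suc i)) js"
      and "e = js ! i" and "f = js ! Suc i"
    have split: "js = us @ e # f # vs"
      using i len by (simp add: us_def vs_def e_def f_def Cons_nth_drop_Suc)
    have lus: "length us = i" using i len by (simp add: us_def)
    have lens: "length (us @ vs) = r - 1" "Suc (length (us @ vs)) = r" using len split i by auto
    have sub: "set js \<subseteq> {1..n}" using st supp_subset[OF Xs] by simp
    have so_e: "sorted_wrt (<) (us @ e # vs)" and so_f: "sorted_wrt (<) (us @ f # vs)"
      and ef: "e < f" using so split by (auto simp: sorted_wrt_append)
    have dist: "distinct js" using so by (simp add: js)
    have bas: "basis_om M (set (g # us @ vs))" "distinct (g # us @ vs)" if "g \<in> {e, f}" for g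
    proof -
      show d: "distinct (g # us @ vs)" using dist split that by auto
      have "set (g # us @ vs) \<subseteq> ground M" using sub split gr that by auto
      moreover have "card (set (g # us @ vs)) = rank_om M"
        using distinct_card[OF d] lens r by simp
      ultimately show "basis_om M (set (g # us @ vs))" using un by (auto simp: uniform_om_def)
    qed
    have "\<chi> (f # us @ vs) = - X e * X f * \<chi> (e # us @ vs)"
    proof -
      have piv: "\<forall>e f xs X. e \<noteq> f \<and> Suc (length xs) = rank_om M \<and>
        distinct (e # xs) \<and> basis_om M (set (e # xs)) \<and>
        distinct (f # xs) \<and> basis_om M (set (f # xs)) \<and>
        X \<in> circuits M \<and> supp X \<subseteq> set (e # f # xs) \<longrightarrow>
        \<chi> (f # xs) = - X e * X f * \<chi> (e # xs)"
        using chi unfolding chirotope_def by (rule conjunct2)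
      have "supp X \<subseteq> set (e # f # us @ vs)" using st split by auto
      then show ?thesis
        using ef lens r bas[of e] bas[of f] X by (intro piv[rule_format]) auto
    qed
    moreover have "\<chi> (us @ e # vs) = (-1) ^ i * \<chi> (e # us @ vs)"
      using chirotope_move[OF chi, of e us vs] lens r lus sub split gr by auto
    moreover have "\<chi> (us @ f # vs) = (-1) ^ i * \<chi> (f # us @ vs)"
      using chirotope_move[OF chi, of f us vs] lens r lus sub split gr by auto
    ultimately have rel: "\<chi> (us @ f # vs) = - X e * X f * \<chi> (us @ e # vs)" by simp
    define P where "P = (\<Prod>l\<in>{..<r} - {i}. A (Suc l) ((us @ e # vs) ! l))"
    have prod_e: "\<chi> (us @ e # vs) = A (Suc i) e * P"
    proof -
      have "\<chi> (us @ e # vs) = (\<Prod>l<r. A (Suc l) ((us @ e # vs) ! l))"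
        using prd[of "us @ e # vs"] so_e lens sub split by auto
      also have "\<dots> = A (Suc i) ((us @ e # vs) ! i) * P"
        unfolding P_def using i by (intro prod.remove) auto
      finally show ?thesis using lus by (simp add: nth_append)
    qed
    have prod_f: "\<chi> (us @ f # vs) = A (Suc i) f * P"
    proof -
      have "\<chi> (us @ f # vs) = (\<Prod>l<r. A (Suc l) ((us @ f # vs) ! l))"
        using prd[of "us @ f # vs"] so_f lens sub split by auto
      also have "\<dots> = A (Suc i) ((us @ f # vs) ! i) *
          (\<Prod>l\<in>{..<r} - {i}. A (Suc l) ((us @ f # vs) ! l))"
        using i by (intro prod.remove) auto
      also have "(\<Prod>l\<in>{..<r} - {i}. A (Suc l) ((us @ f # vs) ! l)) = P"
        unfolding P_def by (rule prod.cong) (auto simp: nth_append nth_Cons' lus)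
      finally show ?thesis using lus by (simp add: nth_append)
    qed
    have Pne: "P \<noteq> 0"
    proof -
      have "A (Suc l) ((us @ e # vs) ! l) \<noteq> 0" if "l < r" for l
      proof -
        have "(us @ e # vs) ! l \<in> set (us @ e # vs)"
          using that lens by (intro nth_mem) simp
        then have "(us @ e # vs) ! l \<in> {1..n}" using sub split by auto
        moreover have "Suc l \<in> {1..r}" using that by simp
        ultimately have "A (Suc l) ((us @ e # vs) ! l) \<in> {-1, 1}" using A by blast
        then show ?thesis by auto
      qed
      then show ?thesis by (auto simp: P_def)
    qed
    have Ae: "A (Suc i) e \<in> {-1, 1}"
    proof -
      have "Suc i \<in> {1..r}" "e \<in> {1..n}" using i sub split by auto
      then show "A (Suc i) e \<in> {-1, 1}" using A by blast
    qed
    have "X e \<in> {-1, 0, 1}" using Xs unfolding sign_vectors_def by blast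
    moreover have "X e \<noteq> 0" using supp_iff[OF Xs, of e] st split by auto
    ultimately have Xe: "X e \<in> {-1, 1}" by auto
    have "A (Suc i) f * P = - X e * X f * (A (Suc i) e * P)"
      using rel unfolding prod_e prod_f .
    then have "X f = - A (Suc i) e * A (Suc i) f * X e" by (rule solve_sign[OF Ae Xe Pne])
    then show "X (js ! Suc i) = - A (Suc i) (js ! i) * A (Suc i) (js ! Suc i) * X (js ! i)"
      unfolding e_def f_def .
  qed
  show ?thesis unfolding gr[symmetric]
    by (rule circuits_eqI[where s = "\<lambda>js i. - A (Suc i) (js ! i) * A (Suc i) (js ! Suc i)",
        OF om un r]) (fact step)
qed

end

theory Submission
  imports Defs
begin

text \<open>
  Both sides are compared with \<open>2 * n\<close>.  A circuit has an odd number \<open>2 * k + 3\<close> of elements, so \<open>R\<close>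
  gives a \<open>k\<close>-neighborly reorientation exactly when the signs of every reoriented circuit add up
  to \<open>1\<close> or \<open>-1\<close>; call such an \<open>R\<close> balanced.

  Lower bound (\<open>c_alt_ge\<close>).  Reorienting an initial segment of an alternating circuit of odd
  length negates a prefix of an alternating sum.  That prefix is \<open>0\<close> or the whole sum, so the sum
  stays \<open>1\<close> or \<open>-1\<close>.  The proper initial segments and their complements are \<open>2 * n\<close> balanced sets.

  Upper bound (\<open>f_LOM_le\<close>).  Reveal the elements \<open>1, 2, \<dots>\<close> one after the other and count the traces
  on \<open>{1..m}\<close> of balanced sets.  There are at most \<open>2\<close> for \<open>m = 1\<close>, and the step from \<open>m\<close> to \<open>m + 1\<close>
  adds exactly the number of twins, that is, of traces \<open>S\<close> on \<open>{1..m}\<close> for which both \<open>S\<close> and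
  \<open>S \<union> {m + 1}\<close> are traces on \<open>{1..m + 1}\<close>.  It remains to see that a twin is determined up to
  complement.

  \<^item> Let \<open>m \<ge> 2 * k + 3\<close> (\<open>unique_twin_of_circuits\<close>; this holds in every uniform oriented matroid).
    In a circuit with largest element \<open>m + 1\<close>, both signs at \<open>m + 1\<close> are possible, so the other
    \<open>2 * k + 2\<close> signs add up to \<open>0\<close>.  Subtracting this for two twins shows that every set of
    \<open>2 * k + 2\<close> elements of \<open>{1..m}\<close> meets their symmetric difference in an even number of elements.
    Exchanging one element shows that the symmetric difference is empty or everything.

  \<^item> Let \<open>m + 1 \<le> n - 3 * k\<close> (\<open>unique_twin_of_LOM\<close>; here the matrix is used).  Consecutive signs of
    a circuit agree where the corresponding row changes sign.  Suppose that, after the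
    reorientation, the first row changes between \<open>j1\<close> and \<open>j2\<close> and the second between \<open>j2\<close> and \<open>j3\<close>,
    with at least \<open>3 * k\<close> columns left beyond \<open>j3\<close>.  Form \<open>k\<close> blocks of three of them and choose from each
    block two columns whose entries in the relevant row agree.  The result is a circuit whose
    first three signs are equal while all others cancel in pairs, so its sum is \<open>3\<close> or \<open>-3\<close>.
    Hence this never happens for balanced sets (\<open>balanced_LOM_no_early_repeats\<close>).  Taking
    \<open>j3 = m + 1\<close>, where both signs are possible, the first row reoriented by a twin cannot
    change at all on \<open>{1..m}\<close>.

  Since \<open>n - 3 * k \<ge> 3 * k + 2 \<ge> 2 * k + 3\<close>, the two ranges cover all \<open>m < n\<close>.
\<close>

section \<open>Neighborliness as a condition on sums of signs\<close>

definition flip :: "nat set \<Rightarrow> nat \<Rightarrow> int" where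
  "flip R e = (if e \<in> R then -1 else 1)"

lemma flip_cases: "flip R e = 1 \<or> flip R e = -1"
  by (simp add: flip_def)

lemma flip_square [simp]: "flip R e * flip R e = 1"
  by (simp add: flip_def)

definition balanced :: "nat om \<Rightarrow> nat set \<Rightarrow> bool" where
  "balanced M R \<longleftrightarrow> (\<forall>X \<in> circuits M. \<bar>\<Sum>e\<in>supp X. flip R e * X e\<bar> \<le> 1)"

lemma balanced_cong:
  assumes "balanced M R" "X \<in> circuits M" "R \<inter> supp X = S \<inter> supp X"
  shows "\<bar>\<Sum>e\<in>supp X. flip S e * X e\<bar> \<le> 1"
proof -
  have "(\<Sum>e\<in>supp X. flip S e * X e) = (\<Sum>e\<in>supp X. flip R e * X e)"
    using assms(3) by (intro sum.cong) (auto simp: flip_def)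
  then show ?thesis using assms(1,2) by (simp add: balanced_def)
qed

lemma sum_supp_eq_card_diff:
  assumes "finite (supp Z)"
  shows "(\<Sum>e\<in>supp Z. Z e) = int (card (pos Z)) - int (card (neg Z))"
proof -
  have fin: "finite (pos Z)" "finite (neg Z)" using assms by (auto simp: supp_def)
  have "(\<Sum>e\<in>supp Z. Z e) = (\<Sum>e\<in>pos Z. Z e) + (\<Sum>e\<in>neg Z. Z e)"
    unfolding supp_def using fin by (intro sum.union_disjoint) (auto simp: pos_def neg_def)
  then show ?thesis by (simp add: pos_def neg_def)
qed

text \<open>If \<open>p + q = 2 * k + 3\<close>, then both \<open>p\<close> and \<open>q\<close> exceed \<open>k\<close> exactly when \<open>p\<close> and \<open>q\<close> differ by
  one.\<close>

lemma neighborly_reorient_iff_balanced: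
  assumes "\<And>X. X \<in> circuits M \<Longrightarrow> card (supp X) = 2 * k + 3"
  shows "neighborly k (reorient R M) \<longleftrightarrow> balanced M R"
proof -
  have "(card (pos (\<lambda>e. if e \<in> R then - X e else X e)) > k \<and>
      card (neg (\<lambda>e. if e \<in> R then - X e else X e)) > k) \<longleftrightarrow>
      \<bar>\<Sum>e\<in>supp X. flip R e * X e\<bar> \<le> 1" (is "?L = ?R") if X: "X \<in> circuits M" for X
  proof -
    let ?Z = "\<lambda>e. if e \<in> R then - X e else X e"
    have sZ: "supp ?Z = supp X" by (auto simp: supp_def pos_def neg_def)
    have c: "card (supp X) = 2 * k + 3" using assms[OF X] .
    then have fin: "finite (supp X)" using card_ge_0_finite[of "supp X"] by simp
    then have "finite (pos ?Z)" "finite (neg ?Z)"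
      unfolding sZ[symmetric] by (auto simp: supp_def)
    then have "card (supp ?Z) = card (pos ?Z) + card (neg ?Z)"
      unfolding supp_def by (intro card_Un_disjoint) (auto simp: pos_def neg_def)
    then have tot: "card (pos ?Z) + card (neg ?Z) = 2 * k + 3" using sZ c by metis
    have "(\<Sum>e\<in>supp X. flip R e * X e) = (\<Sum>e\<in>supp ?Z. ?Z e)"
      unfolding sZ by (intro sum.cong) (auto simp: flip_def)
    also have "\<dots> = int (card (pos ?Z)) - int (card (neg ?Z))"
      using fin sZ by (intro sum_supp_eq_card_diff) metis
    finally show ?thesis using tot by auto
  qed
  then show ?thesis by (auto simp: neighborly_def balanced_def reorient_def)
qed

lemma f_om_eq_card_balanced:
  assumes "\<And>X. X \<in> circuits M \<Longrightarrow> card (supp X) = 2 * k + 3"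
  shows "f_om M k = card {R. R \<subseteq> ground M \<and> balanced M R}"
  unfolding f_om_def using neighborly_reorient_iff_balanced[of M k] assms by simp

section \<open>Counting a family of sets by revealing the elements in turn\<close>

definition traces :: "nat set set \<Rightarrow> nat \<Rightarrow> nat set set" where
  "traces \<R> m = (\<lambda>R. R \<inter> {1..m}) ` \<R>"

text \<open>A twin is a trace on \<open>{1..m}\<close> that continues to \<open>m + 1\<close> in both ways.\<close>

definition twin :: "nat set set \<Rightarrow> nat \<Rightarrow> nat set \<Rightarrow> bool" where
  "twin \<R> m S \<longleftrightarrow> S \<subseteq> {1..m} \<and> S \<in> traces \<R> (Suc m) \<and> insert (Suc m) S \<in> traces \<R> (Suc m)"

text \<open>Two twins are equal or complementary in \<open>{1..m}\<close>.  Comparing two elements \<open>a\<close> and \<open>b\<close> is the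
  form in which both arguments below deliver this.\<close>

definition unique_twin :: "nat set set \<Rightarrow> nat \<Rightarrow> bool" where
  "unique_twin \<R> m \<longleftrightarrow> (\<forall>S T a b. twin \<R> m S \<and> twin \<R> m T \<and> a \<in> {1..m} \<and> b \<in> {1..m} \<longrightarrow>
     (a \<in> S \<longleftrightarrow> a \<in> T) = (b \<in> S \<longleftrightarrow> b \<in> T))"

lemma finite_traces: "finite (traces \<R> m)"
  by (rule finite_subset[of _ "Pow {1..m}"]) (auto simp: traces_def)

lemma card_twins_le_2:
  assumes "unique_twin \<R> m"
  shows "card {S. twin \<R> m S} \<le> 2"
proof (cases "\<exists>S. twin \<R> m S")
  case True
  then obtain S where S: "twin \<R> m S" by blast
  have "T = S \<or> T = {1..m} - S" if T: "twin \<R> m T" for T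
  proof (rule ccontr)
    assume not: "\<not> (T = S \<or> T = {1..m} - S)"
    have sub: "S \<subseteq> {1..m}" "T \<subseteq> {1..m}" using S T by (auto simp: twin_def)
    obtain a where "a \<in> {1..m}" "\<not> (a \<in> S \<longleftrightarrow> a \<in> T)" using not sub by blast
    moreover obtain b where "b \<in> {1..m}" "b \<in> S \<longleftrightarrow> b \<in> T" using not sub by blast
    ultimately show False using assms S T unfolding unique_twin_def by blast
  qed
  then have "{T. twin \<R> m T} \<subseteq> {S, {1..m} - S}" by blast
  then have "card {T. twin \<R> m T} \<le> card {S, {1..m} - S}" by (intro card_mono) auto
  also have "\<dots> \<le> 2" by (simp add: card_insert_if)
  finally show ?thesis .
qed simp

text \<open>Every trace on \<open>{1..m}\<close> continues in one or two ways, and the twins are those with two.\<close>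

lemma card_traces_Suc_le:
  assumes "unique_twin \<R> m"
  shows "card (traces \<R> (Suc m)) \<le> card (traces \<R> m) + 2"
proof -
  let ?F = "traces \<R> (Suc m)"
  \<comment> \<open>\<open>U\<close> and \<open>W\<close> are the traces on \<open>{1..m}\<close> that continue without and with \<open>Suc m\<close>.\<close>
  define U where "U = {S \<in> ?F. Suc m \<notin> S}"
  define V where "V = {S \<in> ?F. Suc m \<in> S}"
  define W where "W = (\<lambda>S. S - {Suc m}) ` V"
  have fin: "finite U" "finite V" "finite W"
    using finite_traces[of \<R> "Suc m"] by (auto simp: U_def V_def W_def)
  have F: "S \<subseteq> {1..Suc m}" if "S \<in> ?F" for S using that by (auto simp: traces_def)
  have restr: "S \<inter> {1..m} \<in> traces \<R> m" if S: "S \<in> ?F" for S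
  proof -
    obtain R where R: "R \<in> \<R>" "S = R \<inter> {1..Suc m}" using S by (auto simp: traces_def)
    then have "S \<inter> {1..m} = R \<inter> {1..m}" by auto
    then show ?thesis using R by (auto simp: traces_def)
  qed
  have U_in: "S \<in> traces \<R> m \<and> S \<subseteq> {1..m}" if S: "S \<in> U" for S
  proof -
    have "S \<subseteq> {1..Suc m}" "Suc m \<notin> S" using F S by (auto simp: U_def)
    then have "S \<subseteq> {1..m}" using atLeastAtMostSuc_conv[of 1 m] by auto
    then show ?thesis using restr[of S] S by (simp add: U_def inf_absorb1)
  qed
  have W_in: "S \<in> traces \<R> m" if S: "S \<in> W" for S
  proof -
    obtain T where T: "T \<in> ?F" "S = T - {Suc m}" using S by (auto simp: W_def V_def)
    then have "S = T \<inter> {1..m}" using F[OF T(1)] atLeastAtMostSuc_conv[of 1 m] by auto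
    then show ?thesis using restr[OF T(1)] by simp
  qed
  have "U \<inter> W \<subseteq> {S. twin \<R> m S}"
  proof
    fix S assume S: "S \<in> U \<inter> W"
    then obtain T where T: "T \<in> V" "S = T - {Suc m}" by (auto simp: W_def)
    then have "insert (Suc m) S = T" by (auto simp: V_def)
    then show "S \<in> {S. twin \<R> m S}" using S T U_in by (auto simp: twin_def U_def V_def)
  qed
  moreover have "finite {S. twin \<R> m S}"
    by (rule finite_subset[of _ "Pow {1..m}"]) (auto simp: twin_def)
  ultimately have UW: "card (U \<inter> W) \<le> 2"
    using card_twins_le_2[OF assms] card_mono order_trans by blast
  have "inj_on (\<lambda>S. S - {Suc m}) V" by (rule inj_onI) (auto simp: V_def)
  then have "card V = card W" by (simp add: W_def card_image)
  moreover have "card ?F = card U + card V"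
  proof -
    have "?F = U \<union> V" "U \<inter> V = {}" by (auto simp: U_def V_def)
    then show ?thesis using fin by (simp add: card_Un_disjoint)
  qed
  moreover have "card U + card W = card (U \<union> W) + card (U \<inter> W)"
    by (rule card_Un_Int[OF fin(1,3)])
  moreover have "card (U \<union> W) \<le> card (traces \<R> m)"
    using U_in W_in by (intro card_mono finite_traces) auto
  ultimately show ?thesis using UW by linarith
qed

lemma card_le_twice_ground:
  assumes sub: "\<R> \<subseteq> Pow {1..n}" and n: "n \<ge> 1"
    and uniq: "\<And>m. 1 \<le> m \<Longrightarrow> m < n \<Longrightarrow> unique_twin \<R> m"
  shows "card \<R> \<le> 2 * n"
proof -
  have bound: "card (traces \<R> m) \<le> 2 * m" if "1 \<le> m" "m \<le> n" for m
    using that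
  proof (induction m rule: dec_induct)
    case base
    have "card (traces \<R> 1) \<le> card (Pow {1::nat})"
      by (intro card_mono) (auto simp: traces_def)
    then show ?case by (simp add: card_Pow)
  next
    case (step m)
    then show ?case using card_traces_Suc_le[OF uniq[of m]] by simp
  qed
  have "traces \<R> n = \<R>"
  proof -
    have "R \<inter> {1..n} = R" if "R \<in> \<R>" for R using that sub by auto
    then show ?thesis by (auto simp: traces_def image_def)
  qed
  then show ?thesis using bound[of n] n by simp
qed

section \<open>Twins of many elements in a uniform oriented matroid\<close>

lemma even_sum_signs_iff:
  fixes z :: "'a \<Rightarrow> int"
  assumes "finite F" "\<And>e. e \<in> F \<Longrightarrow> z e = 1 \<or> z e = -1"
  shows "even (\<Sum>e\<in>F. z e) \<longleftrightarrow> even (card F)"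
  using assms
proof (induction F rule: finite_induct)
  case empty
  then show ?case by simp
next
  case (insert x F)
  have "odd (z x)" using insert.prems[of x] by auto
  moreover have "even (\<Sum>e\<in>F. z e) \<longleftrightarrow> even (card F)" using insert.IH insert.prems by blast
  ultimately show ?case using insert.hyps by simp
qed

text \<open>Both \<open>s + X (Suc m)\<close> and \<open>s - X (Suc m)\<close> lie in \<open>{-1, 0, 1}\<close>, where \<open>s\<close> is the sum in question
  and \<open>X (Suc m)\<close> is \<open>1\<close> or \<open>-1\<close>.\<close>

lemma twin_orthogonal:
  assumes tw: "twin {R. R \<subseteq> E \<and> balanced M R} m S"
    and X: "X \<in> circuits M" "supp X = insert (Suc m) Y" "X (Suc m) \<noteq> 0"
    and Y: "Y \<subseteq> {1..m}"
  shows "(\<Sum>e\<in>Y. flip S e * X e) = 0"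
proof -
  let ?s = "\<Sum>e\<in>Y. flip S e * X e"
  obtain R R' where R: "balanced M R" "S = R \<inter> {1..Suc m}"
    and R': "balanced M R'" "insert (Suc m) S = R' \<inter> {1..Suc m}"
    using tw by (auto simp: twin_def traces_def)
  have Sm: "Suc m \<notin> S" using tw by (auto simp: twin_def)
  have sub: "supp X \<subseteq> {1..Suc m}" using X(2) Y by auto
  have fin: "finite Y" "Suc m \<notin> Y" using Y finite_subset by auto
  have "\<bar>\<Sum>e\<in>supp X. flip S e * X e\<bar> \<le> 1"
    by (rule balanced_cong[OF R(1) X(1)]) (use R(2) sub in blast)
  moreover have "(\<Sum>e\<in>supp X. flip S e * X e) = X (Suc m) + ?s"
    using X(2) fin Sm by (simp add: flip_def)
  moreover have "\<bar>\<Sum>e\<in>supp X. flip (insert (Suc m) S) e * X e\<bar> \<le> 1"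
    by (rule balanced_cong[OF R'(1) X(1)]) (use R'(2) sub in blast)
  moreover have "(\<Sum>e\<in>Y. flip (insert (Suc m) S) e * X e) = ?s"
    using fin(2) by (intro sum.cong) (auto simp: flip_def)
  then have "(\<Sum>e\<in>supp X. flip (insert (Suc m) S) e * X e) = - X (Suc m) + ?s"
    using X(2) fin by (simp add: flip_def)
  ultimately show ?thesis using X(3) by linarith
qed

text \<open>Where two twins agree, their terms in the two sums of \<open>twin_orthogonal\<close> cancel in the
  difference, and where they disagree the terms double.  So a sum of signs over the disagreement
  set vanishes, and this set meets every \<open>(c + 1)\<close>-set in an even number of elements.  If it
  contained \<open>b\<close> but not \<open>a\<close>, then exchanging \<open>a\<close> for \<open>b\<close> in a \<open>(c + 1)\<close>-set would change the
  parity.\<close>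

lemma unique_twin_of_circuits:
  assumes X: "circuits M \<subseteq> sign_vectors {1..n}"
    and ex: "\<And>J. J \<subseteq> {1..n} \<Longrightarrow> card J = c + 2 \<Longrightarrow> \<exists>X\<in>circuits M. supp X = J"
    and m: "c + 2 \<le> m" "m < n"
  shows "unique_twin {R. R \<subseteq> E \<and> balanced M R} m"
proof -
  have even_agree: "even (card (Y \<inter> {e. e \<in> S \<longleftrightarrow> e \<notin> T}))"
    if S: "twin {R. R \<subseteq> E \<and> balanced M R} m S" and T: "twin {R. R \<subseteq> E \<and> balanced M R} m T"
      and Y: "Y \<subseteq> {1..m}" "card Y = c + 1" for S T Y
  proof -
    let ?D = "{e. e \<in> S \<longleftrightarrow> e \<notin> T}"
    have finY: "finite Y" and Sm: "Suc m \<notin> Y" using Y(1) finite_subset by auto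
    then have "insert (Suc m) Y \<subseteq> {1..n}" "card (insert (Suc m) Y) = c + 2" using Y m by auto
    then obtain X where X1: "X \<in> circuits M" "supp X = insert (Suc m) Y" using ex by blast
    then have Xs: "X \<in> sign_vectors {1..n}" using X by blast
    have Xv: "X e = 1 \<or> X e = -1" if "e \<in> supp X" for e
      using that by (auto simp: supp_def pos_def neg_def)
    have ne: "X (Suc m) \<noteq> 0" using Xv[of "Suc m"] X1(2) by auto
    have "(\<Sum>e\<in>Y. flip S e * X e) - (\<Sum>e\<in>Y. flip T e * X e) = 0"
      using twin_orthogonal[OF S X1 ne Y(1)] twin_orthogonal[OF T X1 ne Y(1)] by simp
    moreover have "(\<Sum>e\<in>Y. flip S e * X e) - (\<Sum>e\<in>Y. flip T e * X e)
        = (\<Sum>e\<in>Y. if e \<in> ?D then 2 * (flip S e * X e) else 0)"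
      unfolding sum_subtractf[symmetric] by (intro sum.cong) (auto simp: flip_def)
    moreover have "\<dots> = (\<Sum>e\<in>Y \<inter> ?D. 2 * (flip S e * X e))"
      using finY by (simp add: sum.inter_restrict)
    ultimately have "(\<Sum>e\<in>Y \<inter> ?D. flip S e * X e) = 0" by (simp add: sum_distrib_left[symmetric])
    moreover have "even (\<Sum>e\<in>Y \<inter> ?D. flip S e * X e) \<longleftrightarrow> even (card (Y \<inter> ?D))"
    proof (rule even_sum_signs_iff)
      fix e assume "e \<in> Y \<inter> ?D"
      then show "flip S e * X e = 1 \<or> flip S e * X e = -1"
        using Xv[of e] X1(2) by (auto simp: flip_def)
    qed (use finY in simp)
    ultimately show ?thesis by simp
  qed
  have "\<not> (a \<in> S \<longleftrightarrow> a \<in> T)"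
    if S: "twin {R. R \<subseteq> E \<and> balanced M R} m S" and T: "twin {R. R \<subseteq> E \<and> balanced M R} m T"
      and a: "a \<in> {1..m}" and b: "b \<in> {1..m}" "\<not> (b \<in> S \<longleftrightarrow> b \<in> T)" for S T a b
  proof
    assume ag: "a \<in> S \<longleftrightarrow> a \<in> T"
    then have ab: "a \<noteq> b" using b by blast
    then have "card ({1..m} - {a, b}) = m - 2" using a b by (simp add: card_Diff_subset)
    then have "c \<le> card ({1..m} - {a, b})" using m by simp
    then obtain W where W: "W \<subseteq> {1..m} - {a, b}" "card W = c"
      using obtain_subset_with_card_n by metis
    let ?D = "{e. e \<in> S \<longleftrightarrow> e \<notin> T}"
    have finW: "finite W" using W(1) finite_subset by auto
    have new: "a \<notin> W" "b \<notin> W" using W by auto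
    have "even (card (insert a W \<inter> ?D))" "even (card (insert b W \<inter> ?D))"
      using W a b new finW by (intro even_agree[OF S T]; auto)+
    moreover have "insert a W \<inter> ?D = W \<inter> ?D" "insert b W \<inter> ?D = insert b (W \<inter> ?D)"
      using ag b by auto
    ultimately show False using finW new by simp
  qed
  then show ?thesis unfolding unique_twin_def by blast
qed

section \<open>Twins of few elements in a Lawrence oriented matroid\<close>

lemma LOM_ex_circuit:
  fixes J :: "nat \<Rightarrow> nat"
  assumes LOM: "is_LOM_of r n A M"
    and A: "\<forall>i\<in>{1..r}. \<forall>j\<in>{1..n}. A i j \<in> {-1, 1}"
    and J: "\<And>i. i < r \<Longrightarrow> J i < J (Suc i)" "\<And>i. i \<le> r \<Longrightarrow> J i \<in> {1..n}"
  obtains X where "X \<in> circuits M" "supp X = J ` {..r}" "inj_on J {..r}"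
    "\<And>i. i < r \<Longrightarrow> X (J (Suc i)) = - A (Suc i) (J i) * A (Suc i) (J (Suc i)) * X (J i)"
proof -
  have om: "oriented_matroid M" and gr: "ground M = {1..n}" and rk: "rank_om M = r"
    and un: "uniform_om M" using LOM by (auto simp: is_LOM_of_def)
  have less: "J i < J j" if "i < j" "j \<le> r" for i j
    using that
  proof (induction j)
    case (Suc j)
    then show ?case using J(1)[of j] by (cases "i = j") auto
  qed simp
  have inj: "inj_on J {..r}"
    by (rule linorder_inj_onI) (use less in \<open>auto simp: less_imp_neq\<close>)
  have sub: "J ` {..r} \<subseteq> ground M" using J(2) gr by auto
  have card: "card (J ` {..r}) = Suc (rank_om M)" using card_image[OF inj] rk by simp
  obtain X where X: "X \<in> circuits M" "supp X = J ` {..r}"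
    using uniform_ex_circuit[OF om un sub card] by blast
  define js where "js = map J [0..<Suc r]"
  have "sorted_wrt (<) js" unfolding js_def sorted_wrt_map
    by (rule sorted_wrt_mono_rel[OF _ sorted_wrt_upt]) (use less in auto)
  then have "sorted_list_of_set (set js) = js"
    by (simp add: strict_sorted_iff sorted_list_of_set.idem_if_sorted_distinct)
  moreover have "set js = J ` {..r}"
    by (simp only: js_def set_map set_upt atLeast0LessThan lessThan_Suc_atMost)
  ultimately have js: "sorted_list_of_set (supp X) = js" using X(2) by simp
  have nth: "js ! i = J i" if "i \<le> r" for i using that by (simp add: js_def del: upt_Suc)
  have "\<forall>i<r. X (js ! Suc i) = - A (Suc i) (js ! i) * A (Suc i) (js ! Suc i) * X (js ! i)"
    using X(1) js unfolding is_LOM_of_circuits[OF LOM A] by (simp add: Let_def)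
  then have "X (J (Suc i)) = - A (Suc i) (J i) * A (Suc i) (J (Suc i)) * X (J i)" if "i < r" for i
    using that nth[of i] nth[of "Suc i"] by auto
  then show ?thesis using that X inj by blast
qed

text \<open>Otherwise, a circuit starting with \<open>j1, j2, j3\<close> has three equal signs there.  Its remaining
  \<open>2 * k\<close> elements can be chosen so that the signs cancel in pairs: by the pigeonhole principle, two
  of any three columns agree in the row that links the two elements of a pair.\<close>

lemma balanced_LOM_no_early_repeats:
  assumes LOM: "is_LOM_of (2 * k + 2) n A M"
    and A: "\<forall>i\<in>{1..2 * k + 2}. \<forall>j\<in>{1..n}. A i j \<in> {-1, 1}"
    and R: "balanced M R"
    and j: "1 \<le> j1" "j1 < j2" "j2 < j3" "j3 + 3 * k \<le> n"
  shows "flip R j1 * A 1 j1 = flip R j2 * A 1 j2 \<or> flip R j2 * A 2 j2 = flip R j3 * A 2 j3"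
proof (rule ccontr)
  define b where "b i e = flip R e * A i e" for i e
  have b: "b i e = 1 \<or> b i e = -1" if "i \<in> {1..2 * k + 2}" "e \<in> {1..n}" for i e
  proof -
    have "A i e \<in> {-1, 1}" using A that by blast
    then show ?thesis using flip_cases[of R e] by (auto simp: b_def)
  qed
  assume "\<not> ?thesis"
  then have change: "b 1 j1 \<noteq> b 1 j2" "b 2 j2 \<noteq> b 2 j3" by (auto simp: b_def)
  \<comment> \<open>The \<open>t\<close>-th pair will be the elements \<open>2 * t + 3\<close> and \<open>2 * t + 4\<close> of the circuit, counted from \<open>0\<close>;
    rows are counted from \<open>1\<close>, so row \<open>2 * t + 4\<close> links them.\<close>
  have "\<exists>p q. j3 + 3 * t < p \<and> p < q \<and> q \<le> j3 + 3 * t + 3 \<and> b (2 * t + 4) p = b (2 * t + 4) q"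
    if t: "t < k" for t
  proof -
    let ?i = "2 * t + 4" and ?u = "j3 + 3 * t + 1"
    have "?i \<in> {1..2 * k + 2}" using t by simp
    moreover have "?u \<in> {1..n}" "Suc ?u \<in> {1..n}" "Suc (Suc ?u) \<in> {1..n}" using t j by auto
    ultimately have
      "b ?i ?u = b ?i (Suc ?u) \<or> b ?i ?u = b ?i (Suc (Suc ?u)) \<or> b ?i (Suc ?u) = b ?i (Suc (Suc ?u))"
      using b by metis
    then show ?thesis
    proof (elim disjE)
      assume "b ?i ?u = b ?i (Suc ?u)"
      then show ?thesis by (intro exI[of _ ?u] exI[of _ "Suc ?u"]) auto
    next
      assume "b ?i ?u = b ?i (Suc (Suc ?u))"
      then show ?thesis by (intro exI[of _ ?u] exI[of _ "Suc (Suc ?u)"]) auto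
    next
      assume "b ?i (Suc ?u) = b ?i (Suc (Suc ?u))"
      then show ?thesis by (intro exI[of _ "Suc ?u"] exI[of _ "Suc (Suc ?u)"]) auto
    qed
  qed
  then obtain p q where pq: "\<And>t. t < k \<Longrightarrow> j3 + 3 * t < p t" "\<And>t. t < k \<Longrightarrow> p t < q t"
    "\<And>t. t < k \<Longrightarrow> q t \<le> j3 + 3 * t + 3"
    "\<And>t. t < k \<Longrightarrow> b (2 * t + 4) (p t) = b (2 * t + 4) (q t)"
    by metis
  define J where "J i = (if i = 0 then j1 else if i = 1 then j2 else if i = 2 then j3
    else if odd i then p ((i - 3) div 2) else q ((i - 4) div 2))" for i
  have J0: "J 0 = j1" "J 1 = j2" "J 2 = j3" by (auto simp: J_def)
  have Jpq: "J (2 * t + 3) = p t" "J (2 * t + 4) = q t" for t by (auto simp: J_def)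
  have split: "i = 0 \<or> i = 1 \<or> i = 2 \<or> (\<exists>t. i = 2 * t + 3) \<or> (\<exists>t. i = 2 * t + 4)" for i :: nat
    by presburger
  have J_less: "J i < J (Suc i)" if i: "i < 2 * k + 2" for i
    using split[of i]
  proof (elim disjE exE)
    fix t assume t: "i = 2 * t + 3"
    then have "J (Suc i) = q t" "t < k" using Jpq(2)[of t] i by (simp_all add: numeral_eq_Suc)
    then show ?thesis using Jpq(1)[of t] t pq(2)[of t] by simp
  next
    fix t assume t: "i = 2 * t + 4"
    then have "Suc t < k" using i by simp
    moreover have "J (Suc i) = p (Suc t)" using Jpq(1)[of "Suc t"] t by (simp add: numeral_eq_Suc)
    ultimately show ?thesis using Jpq(2)[of t] t pq(1)[of "Suc t"] pq(3)[of t] by simp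
  next
    assume t: "i = 2"
    have "J 3 = p 0" using Jpq(1)[of 0] by simp
    then show ?thesis using t J0 i pq(1)[of 0] by simp
  qed (use J0 j in \<open>auto simp: numeral_eq_Suc\<close>)
  have J_in: "J i \<in> {1..n}" if i: "i \<le> 2 * k + 2" for i
    using split[of i]
  proof (elim disjE exE)
    fix t assume t: "i = 2 * t + 3"
    then have "t < k" using i by simp
    then show ?thesis using Jpq[of t] pq(1,2,3)[of t] t j by simp
  next
    fix t assume t: "i = 2 * t + 4"
    then have "t < k" using i by simp
    then show ?thesis using Jpq[of t] pq(1,2,3)[of t] t j by simp
  qed (use J0 j in auto)
  obtain X where X: "X \<in> circuits M" "supp X = J ` {..2 * k + 2}" "inj_on J {..2 * k + 2}"
    and rec: "\<And>i. i < 2 * k + 2 \<Longrightarrow>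
      X (J (Suc i)) = - A (Suc i) (J i) * A (Suc i) (J (Suc i)) * X (J i)"
    using LOM_ex_circuit[OF LOM A, of J, OF J_less J_in] by blast
  define Z where "Z e = flip R e * X e" for e
  have Zrec: "Z (J (Suc i)) = - (b (Suc i) (J i) * b (Suc i) (J (Suc i))) * Z (J i)"
    if i: "i < 2 * k + 2" for i
  proof -
    have "- (b (Suc i) (J i) * b (Suc i) (J (Suc i))) * Z (J i) =
        flip R (J i) * flip R (J i) * flip R (J (Suc i)) *
          (- A (Suc i) (J i) * A (Suc i) (J (Suc i)) * X (J i))"
      by (simp add: b_def Z_def)
    also have "\<dots> = Z (J (Suc i))"
      unfolding rec[OF i, symmetric] by (simp add: Z_def)
    finally show ?thesis by (rule sym)
  qed
  have repeat: "Z j2 = Z j1" "Z j3 = Z j2"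
  proof -
    have in_n: "j1 \<in> {1..n}" "j2 \<in> {1..n}" "j3 \<in> {1..n}" using j by auto
    have "b 1 j1 * b 1 j2 = -1" "b 2 j2 * b 2 j3 = -1"
      using b[of 1 j1] b[of 1 j2] b[of 2 j2] b[of 2 j3] change in_n by auto
    then show "Z j2 = Z j1" "Z j3 = Z j2"
      using Zrec[of 0] Zrec[of 1] J0 by (auto simp: numeral_eq_Suc)
  qed
  have cancel: "Z (q t) = - Z (p t)" if t: "t < k" for t
  proof -
    have "2 * t + 4 \<in> {1..2 * k + 2}" "p t \<in> {1..n}"
      using t pq(1,2,3)[OF t] j by auto
    then have "b (2 * t + 4) (p t) * b (2 * t + 4) (q t) = 1"
      using b[of "2 * t + 4" "p t"] pq(4)[OF t] by auto
    then show ?thesis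
      using Zrec[of "2 * t + 3"] Jpq[of t] t by (simp add: numeral_eq_Suc)
  qed
  have tail: "(\<Sum>i\<le>2 * l + 2. Z (J i)) = 3 * Z j1" if "l \<le> k" for l
    using that
  proof (induction l)
    case 0
    then show ?case using J0 repeat by (simp add: numeral_eq_Suc)
  next
    case (Suc l)
    have "(\<Sum>i\<le>2 * Suc l + 2. Z (J i)) =
        (\<Sum>i\<le>2 * l + 2. Z (J i)) + Z (J (2 * l + 3)) + Z (J (2 * l + 4))"
      by (simp add: numeral_eq_Suc)
    then show ?case using Suc cancel[of l] Jpq[of l] by simp
  qed
  have "(\<Sum>e\<in>supp X. Z e) = 3 * Z j1"
    using tail[of k] X(2) sum.reindex[OF X(3), of Z] by (simp add: o_def)
  moreover have "\<bar>\<Sum>e\<in>supp X. Z e\<bar> \<le> 1" using R X(1) by (auto simp: balanced_def Z_def)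
  moreover have "Z j1 \<noteq> 0"
  proof -
    have "j1 \<in> supp X" using X(2) J0 by auto
    then have "X j1 = 1 \<or> X j1 = -1" by (auto simp: supp_def pos_def neg_def)
    then show ?thesis using flip_cases[of R j1] by (auto simp: Z_def)
  qed
  ultimately show False by linarith
qed

text \<open>Apply the preceding lemma with \<open>j3 = Suc m\<close> to both continuations of a twin \<open>S\<close>: if the first row
  changed between \<open>a\<close> and \<open>c\<close>, then the second row at \<open>c\<close> would have to agree with both signs at
  \<open>Suc m\<close>.  So \<open>S\<close> makes the first row constant on \<open>{1..m}\<close>.\<close>

lemma unique_twin_of_LOM:
  assumes LOM: "is_LOM_of (2 * k + 2) n A M"
    and A: "\<forall>i\<in>{1..2 * k + 2}. \<forall>j\<in>{1..n}. A i j \<in> {-1, 1}"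
    and m: "Suc m + 3 * k \<le> n"
  shows "unique_twin {R. R \<subseteq> E \<and> balanced M R} m"
proof -
  have row1_less: "flip S a * A 1 a = flip S c * A 1 c"
    if S: "twin {R. R \<subseteq> E \<and> balanced M R} m S" and ac: "1 \<le> a" "a < c" "c \<le> m" for S a c
  proof (rule ccontr)
    assume ne: "flip S a * A 1 a \<noteq> flip S c * A 1 c"
    obtain R R' where R: "balanced M R" "S = R \<inter> {1..Suc m}"
      and R': "balanced M R'" "insert (Suc m) S = R' \<inter> {1..Suc m}"
      using S by (auto simp: twin_def traces_def)
    have Sm: "Suc m \<notin> S" using S by (auto simp: twin_def)
    have eq: "flip R e = flip S e" "flip R' e = flip S e" if "e \<in> {1..m}" for e
    proof -
      have "e \<in> R \<longleftrightarrow> e \<in> S" using R(2) that by auto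
      moreover have "e \<in> R' \<longleftrightarrow> e \<in> insert (Suc m) S" using R'(2) that by auto
      ultimately show "flip R e = flip S e" "flip R' e = flip S e"
        using that by (auto simp: flip_def)
    qed
    have "Suc m \<notin> R" "Suc m \<in> R'" using R(2) R'(2) Sm by auto
    then have fm: "flip R (Suc m) = 1" "flip R' (Suc m) = -1" by (auto simp: flip_def)
    have ac': "a \<in> {1..m}" "c \<in> {1..m}" "c < Suc m" using ac by auto
    have "flip S c * A 2 c = A 2 (Suc m)"
      using balanced_LOM_no_early_repeats[OF LOM A R(1) ac(1,2) ac'(3) m] ne fm eq ac' by simp
    moreover have "flip S c * A 2 c = - A 2 (Suc m)"
      using balanced_LOM_no_early_repeats[OF LOM A R'(1) ac(1,2) ac'(3) m] ne fm eq ac' by simp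
    moreover have "A 2 (Suc m) \<in> {-1, 1}"
    proof -
      have "2 \<in> {1..2 * k + 2}" "Suc m \<in> {1..n}" using m by auto
      then show ?thesis using A by blast
    qed
    ultimately show False by auto
  qed
  have row1: "flip S a * A 1 a = flip S c * A 1 c"
    if S: "twin {R. R \<subseteq> E \<and> balanced M R} m S" and "a \<in> {1..m}" "c \<in> {1..m}" for S a c
    using row1_less[OF S, of a c] row1_less[OF S, of c a] that by (cases a c rule: linorder_cases) auto
  show ?thesis unfolding unique_twin_def
  proof (intro allI impI, elim conjE)
    fix S T a c
    assume S: "twin {R. R \<subseteq> E \<and> balanced M R} m S" and T: "twin {R. R \<subseteq> E \<and> balanced M R} m T"
      and a: "a \<in> {1..m}" and c: "c \<in> {1..m}"
    have "1 \<in> {1..2 * k + 2}" "a \<in> {1..n}" "c \<in> {1..n}" using a c m by auto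
    then have "A 1 a \<in> {-1, 1}" "A 1 c \<in> {-1, 1}" using A by blast+
    then show "(a \<in> S \<longleftrightarrow> a \<in> T) = (c \<in> S \<longleftrightarrow> c \<in> T)"
      using row1[OF S a c] row1[OF T a c] by (auto simp: flip_def split: if_splits)
  qed
qed

section \<open>The two bounds\<close>

lemma f_LOM_le:
  assumes k: "k \<ge> 1" and n: "n \<ge> 6 * k + 2" and M: "is_LOM (2 * k + 2) n M"
  shows "f_om M k \<le> 2 * n"
proof -
  obtain A where A: "\<forall>i\<in>{1..2 * k + 2}. \<forall>j\<in>{1..n}. A i j \<in> {-1, 1}"
    and LOM: "is_LOM_of (2 * k + 2) n A M" using M by (auto simp: is_LOM_def)
  have om: "oriented_matroid M" and gr: "ground M = {1..n}" and rk: "rank_om M = 2 * k + 2"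
    and un: "uniform_om M" using LOM by (auto simp: is_LOM_of_def)
  have "card (supp X) = 2 * k + 3" if "X \<in> circuits M" for X
    using uniform_circuit_card[OF om un that] rk by simp
  then have "f_om M k = card {R. R \<subseteq> {1..n} \<and> balanced M R}"
    using f_om_eq_card_balanced gr by metis
  also have "\<dots> \<le> 2 * n"
  proof (rule card_le_twice_ground)
    fix m :: nat assume m: "1 \<le> m" "m < n"
    show "unique_twin {R. R \<subseteq> {1..n} \<and> balanced M R} m"
    proof (cases "Suc m + 3 * k \<le> n")
      case True
      then show ?thesis by (rule unique_twin_of_LOM[OF LOM A])
    next
      case False
      show ?thesis
      proof (rule unique_twin_of_circuits)
        show "circuits M \<subseteq> sign_vectors {1..n}" using om gr by (auto simp: oriented_matroid_def)
        show "\<exists>X\<in>circuits M. supp X = J" if "J \<subseteq> {1..n}" "card J = (2 * k + 1) + 2" for J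
          using uniform_ex_circuit[OF om un, of J] that gr rk by simp
        show "2 * k + 1 + 2 \<le> m" "m < n" using False n k m by auto
      qed
    qed
  qed (use n in auto)
  finally show ?thesis .
qed

lemma sum_alternating:
  fixes x :: int
  shows "(\<Sum>i<l. (-1) ^ i * x) = (if even l then 0 else x)"
  by (induction l) auto

text \<open>If \<open>T\<close> is the sum of the signs of an alternating circuit and \<open>P\<close> the part of it contributed by
  the elements up to \<open>m\<close>, the reoriented sums are \<open>T - 2 * P\<close> and \<open>2 * P - T\<close>.  As the circuit has
  odd length, \<open>T\<close> is its first sign, and \<open>P\<close> is \<open>0\<close> or \<open>T\<close>.\<close>

lemma balanced_alternating_segment:
  assumes R: "R = {1..m} \<or> R = {Suc m..n}"
  shows "balanced (alternating_om (2 * k + 2) n) R"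
  unfolding balanced_def
proof
  fix X assume X: "X \<in> circuits (alternating_om (2 * k + 2) n)"
  define js where "js = sorted_list_of_set (supp X)"
  define x where "x = X (js ! 0)"
  have Xs: "X \<in> sign_vectors {1..n}" and c: "card (supp X) = 2 * k + 3"
    and rec: "\<forall>i<2 * k + 2. X (js ! i) = - X (js ! Suc i)"
    using X by (auto simp: alternating_om_def alternating_vector_def Let_def js_def)
  have fin: "finite (supp X)" using c card_ge_0_finite[of "supp X"] by simp
  have len: "length js = 2 * k + 3" and st: "set js = supp X" and so: "sorted_wrt (<) js"
    and di: "distinct js"
    using c fin by (auto simp: js_def)
  have alt: "X (js ! i) = (-1) ^ i * x" if "i < 2 * k + 3" for i
    using that
  proof (induction i)
    case (Suc i)
    then show ?case using rec[rule_format, of i] by simp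
  qed (simp add: x_def)
  have xv: "\<bar>x\<bar> \<le> 1"
  proof -
    have "x \<in> {-1, 0, 1}" using Xs unfolding sign_vectors_def x_def by blast
    then show ?thesis by auto
  qed
  have sum_js: "(\<Sum>e\<in>supp X. g e) = (\<Sum>i<2 * k + 3. g (js ! i))" for g :: "nat \<Rightarrow> int"
  proof -
    have "bij_betw (\<lambda>i. js ! i) {..<2 * k + 3} (supp X)"
      using bij_betw_nth[OF di] len st by simp
    then show ?thesis by (simp add: sum.reindex_bij_betw)
  qed
  define l where "l = card {i. i < 2 * k + 3 \<and> js ! i \<le> m}"
  \<comment> \<open>The elements up to \<open>m\<close> are the first \<open>l\<close> ones of the circuit.\<close>
  have low: "{i. i < 2 * k + 3 \<and> js ! i \<le> m} = {..<l}"
  proof -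
    let ?L = "{i. i < 2 * k + 3 \<and> js ! i \<le> m}"
    have down: "i \<in> ?L" if "j \<in> ?L" "i \<le> j" for i j
    proof (cases "i = j")
      case False
      then have "js ! i < js ! j" using that so len by (auto simp: sorted_wrt_iff_nth_less)
      then show ?thesis using that by auto
    qed (use that in simp)
    show ?thesis
    proof (cases "?L = {}")
      case False
      have finL: "finite ?L" by simp
      have "?L = {..Max ?L}"
      proof
        show "?L \<subseteq> {..Max ?L}" using Max_ge[OF finL] by auto
        show "{..Max ?L} \<subseteq> ?L" using down[OF Max_in[OF finL False]] by blast
      qed
      then obtain u where "?L = {..u}" by blast
      then show ?thesis unfolding l_def by (simp add: lessThan_Suc_atMost)
    next
      case True
      show ?thesis unfolding l_def True by simp
    qed
  qed
  have l_le: "l \<le> 2 * k + 3"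
  proof -
    have "{..<l} \<subseteq> {..<2 * k + 3}" unfolding low[symmetric] by auto
    then show ?thesis by simp
  qed
  let ?T = "\<Sum>e\<in>supp X. X e" and ?P = "\<Sum>e\<in>supp X. if e \<le> m then X e else 0"
  have T: "?T = x"
    using sum_alternating[of x "2 * k + 3"] alt unfolding sum_js by simp
  have P: "?P = (if even l then 0 else x)"
  proof -
    have "?P = (\<Sum>i<2 * k + 3. if js ! i \<le> m then X (js ! i) else 0)" by (rule sum_js)
    also have "\<dots> = (\<Sum>i\<in>{i\<in>{..<2 * k + 3}. js ! i \<le> m}. X (js ! i))"
      by (rule sum.inter_filter[symmetric]) simp
    also have "{i\<in>{..<2 * k + 3}. js ! i \<le> m} = {..<l}" using low by auto
    also have "(\<Sum>i<l. X (js ! i)) = (\<Sum>i<l. (-1) ^ i * x)"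
      using alt l_le by (intro sum.cong) auto
    finally show ?thesis by (simp add: sum_alternating)
  qed
  have range: "1 \<le> e \<and> e \<le> n" if "e \<in> supp X" for e using supp_subset[OF Xs] that by auto
  from R have "(\<Sum>e\<in>supp X. flip R e * X e) = ?T - 2 * ?P \<or>
      (\<Sum>e\<in>supp X. flip R e * X e) = 2 * ?P - ?T"
  proof
    assume "R = {1..m}"
    then have "(\<Sum>e\<in>supp X. flip R e * X e) = ?T - 2 * ?P"
      unfolding sum_distrib_left sum_subtractf[symmetric]
      by (intro sum.cong) (auto simp: flip_def dest: range)
    then show ?thesis ..
  next
    assume "R = {Suc m..n}"
    then have "(\<Sum>e\<in>supp X. flip R e * X e) = 2 * ?P - ?T"
      unfolding sum_distrib_left sum_subtractf[symmetric]
      by (intro sum.cong) (auto simp: flip_def dest: range)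
    then show ?thesis ..
  qed
  then show "\<bar>\<Sum>e\<in>supp X. flip R e * X e\<bar> \<le> 1" unfolding T P using xv by auto
qed

text \<open>The initial segments \<open>{1..m}\<close> with \<open>m < n\<close> avoid \<open>n\<close>, while their complements contain it, so that
  these are \<open>2 * n\<close> different sets.\<close>

lemma c_alt_ge: "2 * n \<le> c_alt (2 * k + 2) n k"
proof -
  let ?M = "alternating_om (2 * k + 2) n"
  let ?I = "(\<lambda>m. {1..m}) ` {..<n}" and ?C = "(\<lambda>m. {Suc m..n}) ` {..<n}"
  have "card ?I = n" by (subst card_image) (auto simp: inj_on_def)
  moreover have "card ?C = n" by (subst card_image) (auto simp: inj_on_def)
  moreover have "?I \<inter> ?C = {}"
  proof -
    have "n \<notin> S" if "S \<in> ?I" for S using that by auto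
    moreover have "n \<in> S" if "S \<in> ?C" for S using that by auto
    ultimately show ?thesis by blast
  qed
  ultimately have "2 * n = card (?I \<union> ?C)" by (subst card_Un_disjoint) auto
  also have "\<dots> \<le> card {R. R \<subseteq> ground ?M \<and> balanced ?M R}"
  proof (rule card_mono)
    show "finite {R. R \<subseteq> ground ?M \<and> balanced ?M R}" by (simp add: alternating_om_def)
    show "?I \<union> ?C \<subseteq> {R. R \<subseteq> ground ?M \<and> balanced ?M R}"
      using balanced_alternating_segment by (auto simp: alternating_om_def)
  qed
  also have "\<dots> = f_om ?M k"
    by (rule f_om_eq_card_balanced[symmetric]) (simp add: alternating_om_def)
  finally show ?thesis by (simp add: c_alt_def)
qed

theorem theorem2p11:
  fixes k r n :: nat and M :: "nat om"
  assumes "k \<ge> 1"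
    and "r = 2 * k + 2"
    and "n \<ge> 6 * k + 2"
    and "is_LOM r n M"
  shows "f_om M k \<le> c_alt r n k"
  using f_LOM_le[of k n M] c_alt_ge[of n k] assms by simp

end
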